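(* For any $m\in\mathbb N$ and $\delta\in(0,1)$, and for any sequence $\delta_t$ in $(0,1]$ with $\sum_{i=0}^{\lfloor\log_2(m)\rfloor}\delta_{2^i}\le\delta/2$, $$\max_{t\le m}\mathcal B_{\hat n}(t,\delta)\le\mathcal B_N(m,\delta)\le\max_{t\in\{2^i:\,i\in\{0,1,\ldots,\lfloor\log_2(m)\rfloor\}\}}\left(55\,\mathcal B_{\hat n}(t,\delta_t)\ln\left(\frac{et}{\mathcal B_{\hat n}(t,\delta_t)}\right)+24\ln\left(\frac{8\log_2(2m)}{\delta}\right)\right)\log_2(2m).$$
   Context: Let $\mathcal X$ be an instance space and $\mathcal Y=\{-1,+1\}$. A classifier is a measurable function $h:\mathcal X\to\mathcal Y$. Fix a set $\mathcal F$ of classifiers and a probability measure $P$ on $\mathcal X\times\mathcal Y$. Realizable case: there is a target function $f^*\in\mathcal F$ with $\mathbb P(Y=f^*(x)\mid X=x)=1$ for all $x\in\mathcal X$, where $(X,Y)\sim P$. For a set $\mathcal H$ of classifiers, $\mathrm{DIS}(\mathcal H)=\{x\in\mathcal X:\exists h,g\in\mathcal H,\ h(x)\ne g(x)\}$. Let $(x_1,y_1),(x_2,y_2),\ldots$ be i.i.d. with distribution $P$, $S_m=\{(x_1,y_1),\ldots,(x_m,y_m)\}$ ($S_0=\emptyset$), and suppose $y_i=f^*(x_i)$ for all $i$ (true with probability 1). For a finite sample $S$, the version space is $\mathrm{VS}_{\mathcal F,S}=\{h\in\mathcal F:\forall (x,y)\in S,\ h(x)=y\}$. The version space compression set size $\hat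 n(S)=\hat n(\mathcal F,S)$ is the size of a smallest subset $C\subseteq S$ with $\mathrm{VS}_{\mathcal F,C}=\mathrm{VS}_{\mathcal F,S}$. For $m\in\mathbb N\cup\{0\}$, $\delta\in(0,1]$, $$\mathcal B_{\hat n}(m,\delta)=\min\{b\in\mathbb N\cup\{0\}:\mathbb P(\hat n(S_m)\le b)\ge 1-\delta\}.$$ Define $N(m;S_m)=\sum_{t=1}^m \mathbf 1[x_t\in\mathrm{DIS}(\mathrm{VS}_{\mathcal F,S_{t-1}})]$ (the number of labels requested by the CAL active learning algorithm among the first $m$ points), and let $\mathcal B_N(m,\delta)$ be the smallest nonnegative integer $n$ with $\mathbb P(N(m;S_m)\le n)\ge1-\delta$. Convention: $0\ln(1/0)=0\ln(\infty)=0$. *)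

theory Defs
  imports "HOL-Probability.Probability"
begin

definition labels :: "int measure" where
  "labels = count_space {-1, 1}"

definition classifiers :: "'x measure \<Rightarrow> ('x \<Rightarrow> int) set" where
  "classifiers X = measurable X labels"

definition DIS :: "'x measure \<Rightarrow> ('x \<Rightarrow> int) set \<Rightarrow> 'x set" where
  "DIS X H = {x \<in> space X. \<exists>h\<in>H. \<exists>g\<in>H. h x \<noteq> g x}"

definition VS :: "('x \<Rightarrow> int) set \<Rightarrow> ('x \<times> int) set \<Rightarrow> ('x \<Rightarrow> int) set" where
  "VS F S = {h \<in> F. \<forall>(x, y)\<in>S. h x = y}"

(* Version space compression set size; only meant for finite S. *)
definition nhat :: "('x \<Rightarrow> int) set \<Rightarrow> ('x \<times> int) set \<Rightarrow> nat" where
  "nhat F S = (LEAST k. \<exists>C\<subseteq>S. card C = k \<and> VS F C = VS F S)"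

(* Regular conditional distribution of the label Y given the instance X under P. *)
definition cond_label_dist ::
    "'x measure \<Rightarrow> ('x \<times> int) measure \<Rightarrow> ('x \<Rightarrow> int measure) \<Rightarrow> bool" where
  "cond_label_dist X P \<kappa> \<longleftrightarrow>
     \<kappa> \<in> measurable X (prob_algebra labels) \<and>
     (\<forall>A\<in>sets X. \<forall>B\<in>sets labels.
        emeasure P (A \<times> B) = (\<integral>\<^sup>+x\<in>A. emeasure (\<kappa> x) B \<partial>distr P X fst))"

(* Conditional distributions are only determined up to null sets of instances, so
   "P(Y = f x | X = x) = 1 for all x" says that some version of them has this property. *)
definition realizable ::
    "'x measure \<Rightarrow> ('x \<times> int) measure \<Rightarrow> ('x \<Rightarrow> int) set \<Rightarrow> ('x \<Rightarrow> int) \<Rightarrow> bool" where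
  "realizable X P F f \<longleftrightarrow>
     f \<in> F \<and> (\<exists>\<kappa>. cond_label_dist X P \<kappa> \<and> (\<forall>x\<in>space X. measure (\<kappa> x) {f x} = 1))"

(* Independent examples Z 1, Z 2, ... with common distribution P; the index 0 is unused. *)
definition iid_seq :: "'w measure \<Rightarrow> 'z measure \<Rightarrow> (nat \<Rightarrow> 'w \<Rightarrow> 'z) \<Rightarrow> bool" where
  "iid_seq M P Z \<longleftrightarrow>
     prob_space.indep_vars M (\<lambda>_. P) Z {1..} \<and> (\<forall>i\<ge>1. distr M P (Z i) = P)"

definition sample :: "(nat \<Rightarrow> 'w \<Rightarrow> 'z) \<Rightarrow> nat \<Rightarrow> 'w \<Rightarrow> 'z set" where
  "sample Z m \<omega> = (\<lambda>i. Z i \<omega>) ` {1..m}"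

definition num_queries ::
    "'x measure \<Rightarrow> ('x \<Rightarrow> int) set \<Rightarrow> (nat \<Rightarrow> 'w \<Rightarrow> 'x \<times> int) \<Rightarrow> nat \<Rightarrow> 'w \<Rightarrow> nat" where
  "num_queries X F Z m \<omega> =
     (\<Sum>t=1..m. of_bool (fst (Z t \<omega>) \<in> DIS X (VS F (sample Z (t - 1) \<omega>))))"

definition B_nhat ::
    "'w measure \<Rightarrow> ('x \<Rightarrow> int) set \<Rightarrow> (nat \<Rightarrow> 'w \<Rightarrow> 'x \<times> int) \<Rightarrow> nat \<Rightarrow> real \<Rightarrow> nat" where
  "B_nhat M F Z m \<delta> = (LEAST b. \<P>(\<omega> in M. nhat F (sample Z m \<omega>) \<le> b) \<ge> 1 - \<delta>)"

definition B_N ::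
    "'w measure \<Rightarrow> 'x measure \<Rightarrow> ('x \<Rightarrow> int) set \<Rightarrow> (nat \<Rightarrow> 'w \<Rightarrow> 'x \<times> int) \<Rightarrow> nat \<Rightarrow> real \<Rightarrow> nat" where
  "B_N M X F Z m \<delta> = (LEAST n. \<P>(\<omega> in M. num_queries X F Z m \<omega> \<le> n) \<ge> 1 - \<delta>)"

(* Measurability of the disagreement region, jointly in the t sample instances (labelled by
   f) and the test instance. For samples labelled by f it makes nhat and num_queries random
   variables; without it, their distributions need not be defined when F is uncountable. *)
definition measurable_DIS ::
    "'x measure \<Rightarrow> ('x \<Rightarrow> int) set \<Rightarrow> ('x \<Rightarrow> int) \<Rightarrow> bool" where
  "measurable_DIS X F f \<longleftrightarrow>
     (\<forall>t::nat. {(xs, x) \<in> space (PiM {1..t} (\<lambda>_. X) \<Otimes>\<^sub>M X).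
             x \<in> DIS X (VS F ((\<lambda>i. (xs i, f (xs i))) ` {1..t}))}
          \<in> sets (PiM {1..t} (\<lambda>_. X) \<Otimes>\<^sub>M X))"

end

theory Submission
  imports Defs
begin

text \<open>
  Lower bound: the queried points among the first \<open>t\<close> examples already cut out the version space of
  all of them, so the compression set size is pointwise at most the number of queries.

  Upper bound: fix a set \<open>I\<close> of \<open>b \<le> t / 2\<close> indices up to \<open>t\<close>, and let \<open>p\<close> be the probability of the
  disagreement region \<open>D\<close> of the version space of the examples in \<open>I\<close>. Given these examples, the others
  are independent of \<open>D\<close>, so that the indicator that no example up to \<open>t\<close> lies in \<open>D\<close>, multiplied by
  \<open>(3 / 2) ^ N\<close> with \<open>N\<close> the number of examples from \<open>t + 1\<close> to \<open>2 t\<close> in \<open>D\<close>, has expectation at most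
  \<open>((1 - p) (1 + p / 2)\<^sup>2) ^ (t - b) \<le> 1\<close>. By Markov's inequality and a union bound over \<open>I\<close>, the
  probability that the compression set size is at most \<open>b\<close> and yet at least \<open>n\<close> queries are made between
  \<open>t + 1\<close> and \<open>2 t\<close> is at most \<open>(t choose b) (2 / 3) ^ n\<close>. A further union bound over the epochs
  \<open>t = 2 ^ i\<close> gives the claim; an epoch with \<open>2 b > t\<close> satisfies the bound trivially.
\<close>

section \<open>Exponential bound on binomial coefficients\<close>

text \<open>\<open>k ^ k / k!\<close> is the last summand of the Taylor polynomial of
  \<open>exp\<close> at \<open>k\<close>; the other summands and the remainder are
  nonnegative.\<close>

lemma power_self_le_exp_fact: "real k ^ k \<le> exp (real k) * fact k"
proof -
  obtain t where t: "exp (real k) = (\<Sum>i<Suc k. real k ^ i / fact i) + exp t / fact (Suc k) * real k ^ Suc k"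
    using Maclaurin_exp_le[of "real k" "Suc k"] by blast
  have "real k ^ k / fact k \<le> (\<Sum>i<Suc k. real k ^ i / fact i)"
    by (simp add: sum_nonneg)
  also have "\<dots> \<le> exp (real k)"
    unfolding t by simp
  finally show ?thesis
    by (simp add: divide_simps mult.commute)
qed

text \<open>Follows from \<open>(n choose k) * k! \<le> n ^ k\<close> and the bound on
  \<open>k ^ k\<close>. For \<open>k = 0\<close> the factor in front of the logarithm vanishes, so
  the right side is 1, in accordance with the convention for \<open>0 ln (1 / 0)\<close>.\<close>

lemma binomial_le_exp:
  assumes "k \<le> n"
  shows "real (n choose k) \<le> exp (real k * ln (exp 1 * real n / real k))"
proof (cases "k = 0")
  case False
  then have pos: "real k > 0" "real n > 0"
    using assms by auto
  have "real (n choose k) * real k ^ k \<le> real (n choose k) * (exp (real k) * fact k)"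
    by (intro mult_left_mono power_self_le_exp_fact) simp
  also have "\<dots> = exp (real k) * real ((n choose k) * fact k)"
    by simp
  also have "\<dots> \<le> exp (real k) * real (n ^ k)"
    using binomial_fact_pow[of n k] by (intro mult_left_mono) (simp_all only: of_nat_le_iff exp_ge_zero)
  finally have "real (n choose k) \<le> (exp 1 * real n / real k) ^ k"
    using pos by (simp add: field_simps exp_of_nat_mult flip: exp_of_nat_mult)
  also have "\<dots> = exp (real k * ln (exp 1 * real n / real k))"
    using pos by (simp add: exp_of_nat_mult)
  finally show ?thesis .
qed simp

section \<open>Exponential Markov bound for a region determined by part of the sample\<close>

text \<open>The block \<open>I\<close> determines the region, \<open>J\<close> must avoid it, and
  visits of \<open>K\<close> are counted. Once the coordinates in \<open>I\<close> are fixed, the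
  weight \<open>G\<close> is a product of independent factors with total mean at most 1, and
  Markov's inequality applies. In the application \<open>J\<close> is the rest of the first
  \<open>t\<close> examples and \<open>K\<close> the next \<open>t\<close>.\<close>

lemma (in prob_space) prob_disagreement_le:
  fixes x :: "nat \<Rightarrow> 'a \<Rightarrow> 'x" and D :: "(nat \<Rightarrow> 'x) \<Rightarrow> 'x set"
  assumes indep: "indep_vars (\<lambda>_. X) x (I \<union> J \<union> K)"
    and distr: "\<And>i. i \<in> I \<union> J \<union> K \<Longrightarrow> distr M X (x i) = Q"
    and fin [simp]: "finite I" "finite J" "finite K"
    and disj: "I \<inter> J = {}" "I \<inter> K = {}" "J \<inter> K = {}"
    and D: "{(y, z) \<in> space (PiM I (\<lambda>_. X) \<Otimes>\<^sub>M X). z \<in> D y} \<in> sets (PiM I (\<lambda>_. X) \<Otimes>\<^sub>M X)"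
    and card: "card K \<le> 2 * card J" and ne: "K \<noteq> {}"
  shows "prob {\<omega> \<in> space M. (\<forall>j\<in>J. x j \<omega> \<notin> D (\<lambda>i\<in>I. x i \<omega>)) \<and>
           n \<le> card {k \<in> K. x k \<omega> \<in> D (\<lambda>i\<in>I. x i \<omega>)}} \<le> (2 / 3) ^ n"
proof -
  define S where "S = I \<union> (J \<union> K)"
  have S: "finite S" "S \<noteq> {}" "I \<union> J \<union> K = S"
    using ne by (auto simp: S_def)
  note indep = indep[unfolded S] and distr = distr[unfolded S]
  have x [measurable]: "random_variable X (x i)" if "i \<in> S" for i
    using indep that by (auto simp: indep_vars_def)
  \<comment> \<open>A member of \<open>K\<close> exhibits \<open>Q\<close> as the law of a random
    variable, hence as a probability measure on the \<sigma>-algebra of \<open>X\<close>.\<close>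
  obtain k0 where k0: "k0 \<in> K"
    using ne by blast
  have Q: "prob_space Q" "sets Q = sets X"
    using prob_space_distr[OF x] distr[of k0] k0 by (auto simp: S_def)
  note [measurable_cong] = Q(2)
  interpret Q: prob_space Q by fact
  interpret QS: product_prob_space "\<lambda>_. Q" S by standard
  have PS: "distr M (PiM S (\<lambda>_. X)) (\<lambda>\<omega>. \<lambda>i\<in>S. x i \<omega>) = PiM S (\<lambda>_. Q)"
    using indep_vars_iff_distr_eq_PiM'[where M' = "\<lambda>_. X" and X = x and I = S] S(2) indep x
    by (simp add: distr cong: PiM_cong)
  \<comment> \<open>A visit to the region costs the factor 0 for an index in \<open>J\<close> and
    earns the factor \<open>3 / 2\<close> for an index in \<open>K\<close>.\<close>
  define g :: "nat \<Rightarrow> (nat \<Rightarrow> 'x) \<Rightarrow> 'x \<Rightarrow> ennreal"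
    where "g j y z = (if z \<in> D y then if j \<in> K then ennreal (3 / 2) else 0 else 1)" for j y z
  have pred_D [measurable]: "Measurable.pred (PiM I (\<lambda>_. X) \<Otimes>\<^sub>M X) (\<lambda>p. snd p \<in> D (fst p))"
    using D by (simp add: pred_def case_prod_unfold)
  have g_meas: "(\<lambda>p. g j (fst p) (snd p)) \<in> borel_measurable (PiM I (\<lambda>_. X) \<Otimes>\<^sub>M X)" for j
    unfolding g_def by measurable
  define G where "G w = (\<Prod>j\<in>J \<union> K. g j (restrict w I) (w j))" for w
  have G_meas [measurable]: "G \<in> borel_measurable (PiM S (\<lambda>_. X))"
  proof -
    have "(\<lambda>w. g j (restrict w I) (w j)) \<in> borel_measurable (PiM S (\<lambda>_. X))" if "j \<in> J \<union> K" for j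
    proof -
      have "(\<lambda>w. (restrict w I, w j)) \<in> PiM S (\<lambda>_. X) \<rightarrow>\<^sub>M PiM I (\<lambda>_. X) \<Otimes>\<^sub>M X"
        using that by (intro measurable_Pair measurable_restrict_subset measurable_component_singleton)
          (auto simp: S_def)
      from measurable_compose[OF this g_meas[of j]] show ?thesis by simp
    qed
    then show ?thesis
      unfolding G_def by (intro borel_measurable_prod_ennreal)
  qed
  have factor: "(\<integral>\<^sup>+z. (\<Prod>j\<in>J \<union> K. g j y (z j)) \<partial>PiM (J \<union> K) (\<lambda>_. Q)) \<le> 1"
    if y: "y \<in> space (PiM I (\<lambda>_. X))" for y
  proof -
    have Dy [measurable]: "Measurable.pred X (\<lambda>z. z \<in> D y)"
      using measurable_compose[OF measurable_Pair1'[OF y] pred_D] by simp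
    define A where "A = {z \<in> space X. z \<in> D y}"
    have A [measurable]: "A \<in> sets X"
      unfolding A_def by measurable
    define p where "p = Q.prob A"
    have p: "0 \<le> p" "p \<le> 1"
      by (auto simp: p_def)
    have spQ: "space Q = space X"
      using Q(2) by (rule sets_eq_imp_space_eq)
    have gm: "g j y \<in> borel_measurable Q" for j
      unfolding g_def by measurable
    have gK: "integral\<^sup>N Q (g j y) = ennreal (1 + p / 2)" if "j \<in> K" for j
    proof -
      define c where "c = (1 / 2 :: real)"
      have c: "c \<ge> 0"
        by (simp add: c_def)
      have "ennreal (3 / 2) = ennreal (1 + c)"
        by (simp add: c_def)
      also have "\<dots> = 1 + ennreal c"
        by (subst ennreal_plus) (simp_all add: c_def)
      finally have "integral\<^sup>N Q (g j y) = (\<integral>\<^sup>+z. 1 + ennreal c * indicator A z \<partial>Q)"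
        using that by (intro nn_integral_cong) (simp add: g_def A_def spQ indicator_def)
      also have "\<dots> = 1 + ennreal c * emeasure Q A"
        by (simp add: nn_integral_add nn_integral_cmult Q.emeasure_space_1)
      also have "\<dots> = ennreal 1 + ennreal (c * p)"
        using p c by (simp add: Q.emeasure_eq_measure p_def ennreal_mult)
      also have "\<dots> = ennreal (1 + p / 2)"
        using p by (subst ennreal_plus[symmetric]) (simp_all add: c_def)
      finally show ?thesis .
    qed
    have gJ: "integral\<^sup>N Q (g j y) = ennreal (1 - p)" if "j \<in> J" for j
    proof -
      have "integral\<^sup>N Q (g j y) = (\<integral>\<^sup>+z. indicator (space Q - A) z \<partial>Q)"
        using that disj(3) by (intro nn_integral_cong) (auto simp: g_def A_def spQ indicator_def)
      also have "\<dots> = emeasure Q (space Q - A)"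
        by simp
      also have "\<dots> = ennreal (1 - p)"
        by (simp add: Q.emeasure_eq_measure p_def Q.prob_compl)
      finally show ?thesis .
    qed
    have "(\<integral>\<^sup>+z. (\<Prod>j\<in>J \<union> K. g j y (z j)) \<partial>PiM (J \<union> K) (\<lambda>_. Q)) = (\<Prod>j\<in>J \<union> K. integral\<^sup>N Q (g j y))"
      using gm by (intro QS.product_nn_integral_prod) simp_all
    also have "\<dots> = (\<Prod>j\<in>J. ennreal (1 - p)) * (\<Prod>j\<in>K. ennreal (1 + p / 2))"
      using disj(3) by (subst prod.union_disjoint) (simp_all add: gJ gK)
    also have "\<dots> = ennreal ((1 - p) ^ card J * (1 + p / 2) ^ card K)"
      using p by (simp add: ennreal_power ennreal_mult del: ennreal_plus)
    also have "\<dots> \<le> ennreal 1"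
    proof (rule ennreal_leI)
      \<comment> \<open>The cardinality hypothesis pairs each factor from \<open>J\<close> with at
        most two from \<open>K\<close>.\<close>
      have "(1 - p) ^ card J * (1 + p / 2) ^ card K \<le> (1 - p) ^ card J * (1 + p / 2) ^ (2 * card J)"
        using p card by (intro mult_left_mono power_increasing) auto
      also have "\<dots> = ((1 - p) * (1 + p / 2)\<^sup>2) ^ card J"
        by (simp add: power_mult power_mult_distrib)
      also have "\<dots> \<le> 1"
      proof (rule power_le_one)
        \<comment> \<open>This explains the weight \<open>3 / 2\<close>: for a weight
          \<open>1 + c\<close> the linear coefficient would be \<open>2 * c - 1\<close>, which
          vanishes at \<open>c = 1 / 2\<close>.\<close>
        have "(1 - p) * (1 + p / 2)\<^sup>2 = 1 - 3 / 4 * p\<^sup>2 - p ^ 3 / 4"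
          by (simp add: power2_eq_square power3_eq_cube field_simps)
        moreover have "0 \<le> p\<^sup>2" "0 \<le> p ^ 3"
          using p by simp_all
        ultimately show "(1 - p) * (1 + p / 2)\<^sup>2 \<le> 1"
          by linarith
      qed (use p in simp)
      finally show "(1 - p) ^ card J * (1 + p / 2) ^ card K \<le> 1" .
    qed
    finally show ?thesis by simp
  qed
  have "(\<integral>\<^sup>+\<omega>. G (\<lambda>i\<in>S. x i \<omega>) \<partial>M) = integral\<^sup>N (PiM S (\<lambda>_. Q)) G"
    unfolding PS[symmetric] by (subst nn_integral_distr) auto
  \<comment> \<open>Fubini: the inner integral is the expectation for fixed examples in
    \<open>I\<close>, which replaces conditioning.\<close>
  also have "\<dots> = (\<integral>\<^sup>+y. (\<integral>\<^sup>+z. G (merge I (J \<union> K) (y, z)) \<partial>PiM (J \<union> K) (\<lambda>_. Q)) \<partial>PiM I (\<lambda>_. Q))"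
    unfolding S_def using G_meas disj
    by (intro QS.product_nn_integral_fold) (auto simp: S_def cong: measurable_cong_sets sets_PiM_cong)
  also have "\<dots> = (\<integral>\<^sup>+y. (\<integral>\<^sup>+z. (\<Prod>j\<in>J \<union> K. g j y (z j)) \<partial>PiM (J \<union> K) (\<lambda>_. Q)) \<partial>PiM I (\<lambda>_. Q))"
  proof (intro nn_integral_cong)
    fix y z assume y: "y \<in> space (PiM I (\<lambda>_. Q))"
    have "restrict (merge I (J \<union> K) (y, z)) I = y"
      using y by (auto simp: space_PiM PiE_def extensional_def merge_def)
    moreover have "merge I (J \<union> K) (y, z) j = z j" if "j \<in> J \<union> K" for j
      using that disj by (auto simp: merge_def)
    ultimately show "G (merge I (J \<union> K) (y, z)) = (\<Prod>j\<in>J \<union> K. g j y (z j))"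
      by (simp add: G_def)
  qed
  also have "\<dots> \<le> (\<integral>\<^sup>+y. 1 \<partial>PiM I (\<lambda>_. Q))"
    using sets_eq_imp_space_eq[OF sets_PiM_cong[of I I "\<lambda>_. Q" "\<lambda>_. X"]] Q(2)
    by (intro nn_integral_mono factor) auto
  also have "\<dots> = 1"
    by (simp add: prob_space.emeasure_space_1 prob_space_PiM Q(1))
  finally have int: "(\<integral>\<^sup>+\<omega>. G (\<lambda>i\<in>S. x i \<omega>) \<partial>M) \<le> 1" .
  let ?A = "{\<omega> \<in> space M. (\<forall>j\<in>J. x j \<omega> \<notin> D (\<lambda>i\<in>I. x i \<omega>)) \<and>
           n \<le> card {k \<in> K. x k \<omega> \<in> D (\<lambda>i\<in>I. x i \<omega>)}}"
  \<comment> \<open>On the event, every factor from \<open>J\<close> is 1 and at least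
    \<open>n\<close> factors from \<open>K\<close> are \<open>3 / 2\<close>, so \<open>G\<close> is
    at least \<open>(3 / 2) ^ n\<close>.\<close>
  have "emeasure M ?A \<le> emeasure M {\<omega> \<in> space M. 1 \<le> ennreal ((2 / 3) ^ n) * G (\<lambda>i\<in>S. x i \<omega>)}"
  proof (intro emeasure_mono subsetI)
    fix \<omega> assume \<omega>: "\<omega> \<in> ?A"
    let ?D = "D (\<lambda>i\<in>I. x i \<omega>)"
    have r: "restrict (\<lambda>i\<in>S. x i \<omega>) I = (\<lambda>i\<in>I. x i \<omega>)"
      by (auto simp: S_def restrict_def)
    have "G (\<lambda>i\<in>S. x i \<omega>) = (\<Prod>j\<in>J \<union> K. g j (\<lambda>i\<in>I. x i \<omega>) (x j \<omega>))"
      unfolding G_def r by (intro prod.cong) (auto simp: S_def)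
    also have "\<dots> = (\<Prod>j\<in>K. g j (\<lambda>i\<in>I. x i \<omega>) (x j \<omega>))"
      using \<omega> disj(3) by (subst prod.union_disjoint) (auto simp: g_def)
    also have "\<dots> = (\<Prod>j\<in>K. if x j \<omega> \<in> ?D then ennreal (3 / 2) else 1)"
      by (intro prod.cong) (auto simp: g_def)
    also have "\<dots> = ennreal (3 / 2) ^ card {k \<in> K. x k \<omega> \<in> ?D}"
      by (simp add: prod.If_cases Int_def)
    finally have "ennreal ((2 / 3) ^ n) * G (\<lambda>i\<in>S. x i \<omega>)
        = ennreal ((2 / 3) ^ n * (3 / 2) ^ card {k \<in> K. x k \<omega> \<in> ?D})"
      by (simp add: ennreal_power ennreal_mult)
    also have "\<dots> \<ge> ennreal ((2 / 3) ^ n * (3 / 2) ^ n)"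
      using \<omega> by (intro ennreal_leI mult_left_mono power_increasing) auto
    finally show "\<omega> \<in> {\<omega> \<in> space M. 1 \<le> ennreal ((2 / 3) ^ n) * G (\<lambda>i\<in>S. x i \<omega>)}"
      using \<omega> by (simp flip: power_mult_distrib)
  qed measurable
  also have "\<dots> \<le> ennreal ((2 / 3) ^ n) * (\<integral>\<^sup>+\<omega>. G (\<lambda>i\<in>S. x i \<omega>) * indicator (space M) \<omega> \<partial>M)"
    by (rule nn_integral_Markov_inequality) measurable
  also have "(\<integral>\<^sup>+\<omega>. G (\<lambda>i\<in>S. x i \<omega>) * indicator (space M) \<omega> \<partial>M) = (\<integral>\<^sup>+\<omega>. G (\<lambda>i\<in>S. x i \<omega>) \<partial>M)"
    by (intro nn_integral_cong) simp
  also have "ennreal ((2 / 3) ^ n) * \<dots> \<le> ennreal ((2 / 3) ^ n) * 1"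
    by (intro mult_left_mono int) simp
  finally have le: "emeasure M ?A \<le> ennreal ((2 / 3) ^ n) * 1" .
  have "(0::real) \<le> (2 / 3) ^ n"
    by simp
  from le[unfolded emeasure_eq_measure mult_1_right ennreal_le_iff[OF this]] show ?thesis .
qed

section \<open>Compression sets and queries in terms of indices\<close>

text \<open>Subsamples are named by index sets, which do not depend on the random outcome; the union
  bound ranges over them.\<close>

definition labelled :: "('x \<Rightarrow> int) \<Rightarrow> (nat \<Rightarrow> 'x) \<Rightarrow> nat set \<Rightarrow> ('x \<times> int) set" where
  "labelled f x I = (\<lambda>i. (x i, f (x i))) ` I"

definition region ::
    "'x measure \<Rightarrow> ('x \<Rightarrow> int) set \<Rightarrow> ('x \<Rightarrow> int) \<Rightarrow> nat set \<Rightarrow> (nat \<Rightarrow> 'x) \<Rightarrow> 'x set" where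
  "region X F f I x = DIS X (VS F (labelled f x I))"

definition queried ::
    "'x measure \<Rightarrow> ('x \<Rightarrow> int) set \<Rightarrow> ('x \<Rightarrow> int) \<Rightarrow> (nat \<Rightarrow> 'x) \<Rightarrow> nat set" where
  "queried X F f x = {s. x s \<in> region X F f {1..s - 1} x}"

lemma VS_labelled: "VS F (labelled f x I) = {h \<in> F. \<forall>i\<in>I. h (x i) = f (x i)}"
  by (auto simp: VS_def labelled_def)

lemma labelled_cong: "(\<And>i. i \<in> I \<Longrightarrow> x i = y i) \<Longrightarrow> labelled f x I = labelled f y I"
  by (auto simp: labelled_def)

lemma region_restrict: "region X F f I (restrict x I) = region X F f I x"
  unfolding region_def by (subst labelled_cong[of I "restrict x I" x]) auto

lemma region_antimono: "I \<subseteq> J \<Longrightarrow> region X F f J x \<subseteq> region X F f I x"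
  unfolding region_def DIS_def VS_labelled by blast

text \<open>The target \<open>f\<close> lies in the version space, so if two members differ at
  \<open>z\<close>, one of them differs there from \<open>f\<close>.\<close>

lemma notin_region_iff:
  assumes "f \<in> F" "z \<in> space X"
  shows "z \<notin> region X F f I x \<longleftrightarrow> (\<forall>h\<in>F. (\<forall>i\<in>I. h (x i) = f (x i)) \<longrightarrow> h z = f z)"
proof
  assume z: "z \<notin> region X F f I x"
  show "\<forall>h\<in>F. (\<forall>i\<in>I. h (x i) = f (x i)) \<longrightarrow> h z = f z"
    using z assms unfolding region_def DIS_def VS_labelled by blast
next
  assume *: "\<forall>h\<in>F. (\<forall>i\<in>I. h (x i) = f (x i)) \<longrightarrow> h z = f z"
  show "z \<notin> region X F f I x"
  proof
    assume "z \<in> region X F f I x"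
    then obtain h g where "h \<in> F" "\<forall>i\<in>I. h (x i) = f (x i)" "g \<in> F" "\<forall>i\<in>I. g (x i) = f (x i)"
        and "h z \<noteq> g z"
      unfolding region_def DIS_def VS_labelled by blast
    moreover from this * have "h z = f z" "g z = f z"
      by blast+
    ultimately show False by simp
  qed
qed

text \<open>Examples may repeat. A set of examples has an index set of the same size on which
  labelling is injective, and conversely passing from indices to examples cannot increase the
  size.\<close>

lemma nhat_le_iff_VS:
  assumes "finite A"
  shows "nhat F (labelled f x A) \<le> k \<longleftrightarrow>
    (\<exists>I\<subseteq>A. card I \<le> k \<and> VS F (labelled f x I) = VS F (labelled f x A))"
proof
  have "\<exists>C\<subseteq>labelled f x A. card C = nhat F (labelled f x A) \<and> VS F C = VS F (labelled f x A)"
    unfolding nhat_def by (rule LeastI_ex) blast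
  then obtain C where C: "C \<subseteq> labelled f x A" "card C = nhat F (labelled f x A)"
      "VS F C = VS F (labelled f x A)"
    by blast
  then obtain I where I: "I \<subseteq> A" "inj_on (\<lambda>i. (x i, f (x i))) I" "C = labelled f x I"
    unfolding labelled_def subset_image_inj by blast
  moreover assume "nhat F (labelled f x A) \<le> k"
  ultimately show "\<exists>I\<subseteq>A. card I \<le> k \<and> VS F (labelled f x I) = VS F (labelled f x A)"
    using C by (intro exI[of _ I]) (auto simp: labelled_def card_image)
next
  assume "\<exists>I\<subseteq>A. card I \<le> k \<and> VS F (labelled f x I) = VS F (labelled f x A)"
  then obtain I where I: "I \<subseteq> A" "card I \<le> k" "VS F (labelled f x I) = VS F (labelled f x A)"
    by blast
  have "nhat F (labelled f x A) \<le> card (labelled f x I)"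
    unfolding nhat_def using I by (intro Least_le exI[of _ "labelled f x I"]) (auto simp: labelled_def)
  also have "\<dots> \<le> card I"
    unfolding labelled_def using I assms by (intro card_image_le) (auto intro: finite_subset)
  finally show "nhat F (labelled f x A) \<le> k"
    using I by simp
qed

text \<open>Examples in \<open>I\<close> cut out the whole version space exactly when every
  hypothesis agreeing with \<open>f\<close> on them agrees with \<open>f\<close> on all of
  \<open>A\<close>, that is, when no instance of \<open>A\<close> remains in the region of
  \<open>I\<close>.\<close>

lemma nhat_le_iff:
  assumes "finite A" "f \<in> F" and x: "\<And>i. i \<in> A \<Longrightarrow> x i \<in> space X"
  shows "nhat F (labelled f x A) \<le> k \<longleftrightarrow>
    (\<exists>I\<subseteq>A. card I \<le> k \<and> (\<forall>j\<in>A. x j \<notin> region X F f I x))"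
proof -
  have "VS F (labelled f x I) = VS F (labelled f x A) \<longleftrightarrow> (\<forall>j\<in>A. x j \<notin> region X F f I x)"
    if "I \<subseteq> A" for I
  proof -
    have "(\<forall>j\<in>A. x j \<notin> region X F f I x) \<longleftrightarrow>
        (\<forall>j\<in>A. \<forall>h\<in>F. (\<forall>i\<in>I. h (x i) = f (x i)) \<longrightarrow> h (x j) = f (x j))"
      using notin_region_iff[OF assms(2) x] by (intro ball_cong refl) blast
    then show ?thesis
      using that unfolding VS_labelled by blast
  qed
  then show ?thesis
    unfolding nhat_le_iff_VS[OF assms(1)] by blast
qed

text \<open>The queried indices form a compression set. A hypothesis correct on them is correct at
  every \<open>j\<close>, by strong induction: an unqueried instance lies outside the region of its
  predecessors, on which the hypothesis is already known to be correct.\<close>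

lemma nhat_le_card_queried:
  assumes "f \<in> F" and x: "\<And>i. i \<in> {1..t} \<Longrightarrow> x i \<in> space X"
  shows "nhat F (labelled f x {1..t}) \<le> card ({1..t} \<inter> queried X F f x)"
proof -
  have "h (x j) = f (x j)" if h: "h \<in> F" "\<forall>i\<in>{1..t} \<inter> queried X F f x. h (x i) = f (x i)"
    and "j \<in> {1..t}" for h j
    using \<open>j \<in> {1..t}\<close>
  proof (induction j rule: less_induct)
    case (less j)
    show ?case
    proof (cases "j \<in> queried X F f x")
      case False
      then have "x j \<notin> region X F f {1..j - 1} x"
        by (simp add: queried_def)
      moreover have "\<forall>i\<in>{1..j - 1}. h (x i) = f (x i)"
        using less by auto
      ultimately show ?thesis
        using h(1) x[OF less.prems] assms(1) by (simp add: notin_region_iff)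
    qed (use h less.prems in blast)
  qed
  then have "\<forall>j\<in>{1..t}. x j \<notin> region X F f ({1..t} \<inter> queried X F f x) x"
    using notin_region_iff[OF assms(1) x] by blast
  moreover have iff: "nhat F (labelled f x {1..t}) \<le> k \<longleftrightarrow>
      (\<exists>I\<subseteq>{1..t}. card I \<le> k \<and> (\<forall>j\<in>{1..t}. x j \<notin> region X F f I x))" for k
    by (rule nhat_le_iff) (use assms in \<open>simp_all only: finite_atLeastAtMost\<close>)
  ultimately show ?thesis
    by (intro iffD2[OF iff] exI[of _ "{1..t} \<inter> queried X F f x"] conjI Int_lower1 order_refl)
qed

text \<open>The region at any time after \<open>t\<close> is contained in the region of
  \<open>I\<close>, which stays fixed; this removes the dependence of later queries on one
  another.\<close>

lemma card_queried_le_region: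
  assumes "I \<subseteq> {1..t}"
  shows "card ({t<..u} \<inter> queried X F f x) \<le> card {s \<in> {t<..u}. x s \<in> region X F f I x}"
proof (rule card_mono)
  show "{t<..u} \<inter> queried X F f x \<subseteq> {s \<in> {t<..u}. x s \<in> region X F f I x}"
  proof
    fix s assume s: "s \<in> {t<..u} \<inter> queried X F f x"
    then have "{1..t} \<subseteq> {1..s - 1}"
      by auto
    with assms have "region X F f {1..s - 1} x \<subseteq> region X F f I x"
      by (intro region_antimono) (rule subset_trans)
    with s show "s \<in> {s \<in> {t<..u}. x s \<in> region X F f I x}"
      by (auto simp: queried_def)
  qed
qed simp

text \<open>The dyadic blocks cover everything but the index 1, which accounts for the summand
  1.\<close>

lemma card_doubling_le:
  "card ({1..2 ^ n} \<inter> A) \<le> 1 + (\<Sum>i<n. card ({2 ^ i<..2 * 2 ^ i :: nat} \<inter> A))"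
proof (induction n)
  case 0
  have "card ({1..2 ^ 0} \<inter> A) \<le> card {1::nat}"
    by (intro card_mono) auto
  then show ?case by simp
next
  case (Suc n)
  have "{1..2 ^ Suc n} \<inter> A = ({1..2 ^ n} \<inter> A) \<union> ({2 ^ n<..2 * 2 ^ n :: nat} \<inter> A)"
    by auto
  then have "card ({1..2 ^ Suc n} \<inter> A) \<le> card ({1..2 ^ n} \<inter> A) + card ({2 ^ n<..2 * 2 ^ n :: nat} \<inter> A)"
    by (simp add: card_Un_le)
  with Suc show ?case by simp
qed

section \<open>Measurability of disagreement regions\<close>

text \<open>\<open>measurable_DIS\<close> speaks of initial segments \<open>{1..t}\<close> only; a
  bijection between \<open>{1..card I}\<close> and \<open>I\<close> carries it over, as a region
  depends only on the set of examples.\<close>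

lemma sets_region:
  assumes DIS: "measurable_DIS X F f" and "finite I"
  shows "{(y, z) \<in> space (PiM I (\<lambda>_. X) \<Otimes>\<^sub>M X). z \<in> region X F f I y}
    \<in> sets (PiM I (\<lambda>_. X) \<Otimes>\<^sub>M X)"
proof -
  obtain e where e: "bij_betw e {1..card I} I"
    using ex_bij_betw_nat_finite_1[OF \<open>finite I\<close>] by blast
  define \<phi> :: "(nat \<Rightarrow> 'a) \<times> 'a \<Rightarrow> _"
    where "\<phi> p = ((\<lambda>i\<in>{1..card I}. fst p (e i)), snd p)" for p
  let ?A = "{(y, z) \<in> space (PiM {1..card I} (\<lambda>_. X) \<Otimes>\<^sub>M X). z \<in> region X F f {1..card I} y}"
  have \<phi>: "\<phi> \<in> PiM I (\<lambda>_. X) \<Otimes>\<^sub>M X \<rightarrow>\<^sub>M PiM {1..card I} (\<lambda>_. X) \<Otimes>\<^sub>M X"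
    unfolding \<phi>_def
    by (intro measurable_Pair measurable_restrict measurable_snd
        measurable_compose[OF measurable_fst measurable_component_singleton])
      (use e in \<open>auto simp: bij_betw_def\<close>)
  have "?A \<in> sets (PiM {1..card I} (\<lambda>_. X) \<Otimes>\<^sub>M X)"
    using DIS by (simp add: measurable_DIS_def region_def labelled_def)
  from measurable_sets[OF \<phi> this]
  have "\<phi> -` ?A \<inter> space (PiM I (\<lambda>_. X) \<Otimes>\<^sub>M X) \<in> sets (PiM I (\<lambda>_. X) \<Otimes>\<^sub>M X)" .
  also have "\<phi> -` ?A \<inter> space (PiM I (\<lambda>_. X) \<Otimes>\<^sub>M X)
    = {(y, z) \<in> space (PiM I (\<lambda>_. X) \<Otimes>\<^sub>M X). z \<in> region X F f I y}"
  proof -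
    have "labelled f (\<lambda>i\<in>{1..card I}. y (e i)) {1..card I} = labelled f y (e ` {1..card I})" for y
      unfolding labelled_def image_image by (intro image_cong) auto
    moreover have "e ` {1..card I} = I"
      using e by (simp add: bij_betw_def)
    ultimately have "region X F f {1..card I} (\<lambda>i\<in>{1..card I}. y (e i)) = region X F f I y" for y
      by (simp add: region_def)
    then show ?thesis
      using measurable_space[OF \<phi>] by (auto simp: \<phi>_def)
  qed
  finally show ?thesis .
qed

lemma pred_region:
  assumes "measurable_DIS X F f" "finite I"
    and x: "\<And>i. i \<in> insert j I \<Longrightarrow> x i \<in> M \<rightarrow>\<^sub>M X"
  shows "Measurable.pred M (\<lambda>\<omega>. x j \<omega> \<in> region X F f I (\<lambda>i. x i \<omega>))"
proof -
  have pred: "Measurable.pred (PiM I (\<lambda>_. X) \<Otimes>\<^sub>M X) (\<lambda>p. snd p \<in> region X F f I (fst p))"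
    using sets_region[OF assms(1,2)] by (simp add: pred_def case_prod_unfold)
  have "(\<lambda>\<omega>. (\<lambda>i\<in>I. x i \<omega>, x j \<omega>)) \<in> M \<rightarrow>\<^sub>M PiM I (\<lambda>_. X) \<Otimes>\<^sub>M X"
    using x by (intro measurable_Pair measurable_restrict) auto
  from measurable_compose[OF this pred] show ?thesis
    by (simp add: region_restrict)
qed

section \<open>Compression size and queries of a random sample labelled by the target\<close>

locale labelled_sample = prob_space M for M :: "'w measure" +
  fixes X :: "'x measure" and F :: "('x \<Rightarrow> int) set" and f :: "'x \<Rightarrow> int"
    and x :: "nat \<Rightarrow> 'w \<Rightarrow> 'x" and Q :: "'x measure"
  assumes target: "f \<in> F" and DIS: "measurable_DIS X F f"
    and indep: "indep_vars (\<lambda>_. X) x {1..}"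
    and ident: "\<And>i. i \<ge> 1 \<Longrightarrow> distr M X (x i) = Q"
begin

definition comp_size :: "nat \<Rightarrow> 'w \<Rightarrow> nat" where
  "comp_size t \<omega> = nhat F (labelled f (\<lambda>i. x i \<omega>) {1..t})"

definition requests :: "nat set \<Rightarrow> 'w \<Rightarrow> nat" where
  "requests A \<omega> = card (A \<inter> queried X F f (\<lambda>i. x i \<omega>))"

lemma x_measurable: "i \<ge> 1 \<Longrightarrow> random_variable X (x i)"
  using indep by (auto simp: indep_vars_def)

lemma x_space: "i \<ge> 1 \<Longrightarrow> \<omega> \<in> space M \<Longrightarrow> x i \<omega> \<in> space X"
  using measurable_space[OF x_measurable] .

text \<open>Only finite quantifiers over region memberships occur on the right, which yields
  measurability and also the index sets of the union bound.\<close>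

lemma comp_size_le_iff:
  assumes "\<omega> \<in> space M"
  shows "comp_size t \<omega> \<le> k \<longleftrightarrow>
    (\<exists>I\<in>Pow {1..t}. card I \<le> k \<and> (\<forall>j\<in>{1..t}. x j \<omega> \<notin> region X F f I (\<lambda>i. x i \<omega>)))"
proof -
  have "comp_size t \<omega> \<le> k \<longleftrightarrow>
    (\<exists>I\<subseteq>{1..t}. card I \<le> k \<and> (\<forall>j\<in>{1..t}. x j \<omega> \<notin> region X F f I (\<lambda>i. x i \<omega>)))"
    unfolding comp_size_def by (rule nhat_le_iff[OF _ target]) (use assms x_space in simp_all)
  then show ?thesis
    by blast
qed

lemma comp_size_measurable [measurable]: "Measurable.pred M (\<lambda>\<omega>. comp_size t \<omega> \<le> k)"
proof -
  have "Measurable.pred M (\<lambda>\<omega>. \<exists>I\<in>Pow {1..t}. card I \<le> k \<and>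
      (\<forall>j\<in>{1..t}. x j \<omega> \<notin> region X F f I (\<lambda>i. x i \<omega>)))"
  proof (intro pred_intros_finite pred_intros_logic)
    fix I j assume "I \<in> Pow {1..t}" "j \<in> {1..t}"
    then show "Measurable.pred M (\<lambda>\<omega>. x j \<omega> \<in> region X F f I (\<lambda>i. x i \<omega>))"
      by (intro pred_region[OF DIS] x_measurable) (auto intro: finite_subset)
  qed simp_all
  then show ?thesis
    by (subst measurable_cong[OF comp_size_le_iff])
qed

text \<open>Index 0 is excluded since nothing is assumed about \<open>x 0\<close>.\<close>

lemma requests_measurable [measurable]:
  assumes "finite A" "A \<subseteq> {1..}"
  shows "requests A \<in> M \<rightarrow>\<^sub>M count_space UNIV"
proof -
  have *: "requests A \<omega> = (\<Sum>s\<in>A. if s \<in> queried X F f (\<lambda>i. x i \<omega>) then 1 else 0)" for \<omega>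
    using assms(1) by (simp add: requests_def flip: sum.inter_restrict)
  have "Measurable.pred M (\<lambda>\<omega>. s \<in> queried X F f (\<lambda>i. x i \<omega>))" if "s \<in> A" for s
    unfolding queried_def mem_Collect_eq using that assms(2)
    by (intro pred_region[OF DIS] x_measurable) auto
  then show ?thesis
    unfolding * by (intro measurable_sum_nat measurable_If) auto
qed

lemma comp_size_le: "comp_size t \<omega> \<le> t"
  unfolding comp_size_def by (subst nhat_le_iff_VS) (auto intro!: exI[of _ "{1..t}"])

lemma comp_size_le_requests: "\<omega> \<in> space M \<Longrightarrow> comp_size t \<omega> \<le> requests {1..t} \<omega>"
  unfolding comp_size_def requests_def using x_space by (intro nhat_le_card_queried target) auto

lemma prob_comp_size_requests_le_binomial:
  assumes "2 * b \<le> t" "t \<ge> 1"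
  shows "prob {\<omega> \<in> space M. comp_size t \<omega> \<le> b \<and> n \<le> requests {t<..2 * t} \<omega>}
    \<le> real (t choose b) * (2 / 3) ^ n"
proof -
  define C where "C = {I. I \<subseteq> {1..t} \<and> card I = b}"
  define A where "A I = {\<omega> \<in> space M. (\<forall>j\<in>{1..t} - I. x j \<omega> \<notin> region X F f I (\<lambda>i. x i \<omega>)) \<and>
    n \<le> card {s \<in> {t<..2 * t}. x s \<omega> \<in> region X F f I (\<lambda>i. x i \<omega>)}}" for I
  have finC: "finite C"
    by (rule finite_subset[of _ "Pow {1..t}"]) (auto simp: C_def)
  have A_sets [measurable]: "A I \<in> events" if "I \<in> C" for I
  proof -
    have I: "I \<subseteq> {1..t}" "finite I"
      using that by (auto simp: C_def intro: finite_subset)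
    have [measurable]: "Measurable.pred M (\<lambda>\<omega>. x j \<omega> \<in> region X F f I (\<lambda>i. x i \<omega>))" if "j \<ge> 1" for j
      using that I by (intro pred_region[OF DIS] x_measurable) auto
    have c: "card {s \<in> {t<..2 * t}. x s \<omega> \<in> region X F f I (\<lambda>i. x i \<omega>)} =
        (\<Sum>s\<in>{t<..2 * t}. if x s \<omega> \<in> region X F f I (\<lambda>i. x i \<omega>) then 1 else 0)" for \<omega>
      by (subst sum.inter_filter[symmetric]) simp_all
    have [measurable]: "(\<lambda>\<omega>. \<Sum>s\<in>{t<..2 * t}. if x s \<omega> \<in> region X F f I (\<lambda>i. x i \<omega>) then 1 else 0 :: nat)
        \<in> M \<rightarrow>\<^sub>M count_space UNIV"
      by (intro measurable_sum_nat) simp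
    show ?thesis
      unfolding A_def c by measurable
  qed
  have A_prob: "prob (A I) \<le> (2 / 3) ^ n" if "I \<in> C" for I
  proof -
    have I: "I \<subseteq> {1..t}" "finite I" "card I = b"
      using that by (auto simp: C_def intro: finite_subset)
    \<comment> \<open>With \<open>2 * b \<le> t\<close> this gives
      \<open>t \<le> 2 * (t - b)\<close>, the cardinality condition of
      \<open>prob_disagreement_le\<close>.\<close>
    have "card ({1..t} - I) = t - b"
      using I by (simp add: card_Diff_subset)
    moreover have "indep_vars (\<lambda>_. X) x (I \<union> ({1..t} - I) \<union> {t<..2 * t})"
      using I assms by (intro indep_vars_subset[OF indep]) auto
    moreover have "distr M X (x i) = Q" if "i \<in> I \<union> ({1..t} - I) \<union> {t<..2 * t}" for i
      using that I assms by (intro ident) auto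
    ultimately show ?thesis
      unfolding A_def using I assms
      by (intro prob_disagreement_le[where D = "region X F f I" and x = x and I = I and Q = Q and X = X,
            unfolded region_restrict] sets_region[OF DIS]) auto
  qed
  have "{\<omega> \<in> space M. comp_size t \<omega> \<le> b \<and> n \<le> requests {t<..2 * t} \<omega>} \<subseteq> (\<Union>I\<in>C. A I)"
  proof
    fix \<omega> assume \<omega>: "\<omega> \<in> {\<omega> \<in> space M. comp_size t \<omega> \<le> b \<and> n \<le> requests {t<..2 * t} \<omega>}"
    then obtain I where I: "I \<subseteq> {1..t}" "card I \<le> b"
        "\<forall>j\<in>{1..t}. x j \<omega> \<notin> region X F f I (\<lambda>i. x i \<omega>)"
      using comp_size_le_iff by auto
    \<comment> \<open>Enlarging \<open>I\<close> only shrinks its region, so index sets of size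
      exactly \<open>b\<close> suffice and the union has \<open>t choose b\<close> members.\<close>
    obtain I' where I': "I \<subseteq> I'" "I' \<subseteq> {1..t}" "card I' = b"
      using exists_subset_between[of I b "{1..t}"] I assms by auto
    note region_antimono[OF I'(1), of X F f "\<lambda>i. x i \<omega>"]
    moreover have "n \<le> card {s \<in> {t<..2 * t}. x s \<omega> \<in> region X F f I' (\<lambda>i. x i \<omega>)}"
      using \<omega> card_queried_le_region[OF I'(2), of "2 * t" X F f "\<lambda>i. x i \<omega>"]
      by (simp add: requests_def)
    ultimately have "\<omega> \<in> A I'"
      using \<omega> I(3) unfolding A_def by blast
    with I' show "\<omega> \<in> (\<Union>I\<in>C. A I)"
      by (auto simp: C_def)
  qed
  then have "prob {\<omega> \<in> space M. comp_size t \<omega> \<le> b \<and> n \<le> requests {t<..2 * t} \<omega>} \<le> prob (\<Union>I\<in>C. A I)"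
    using finC A_sets by (intro finite_measure_mono) auto
  also have "\<dots> \<le> (\<Sum>I\<in>C. prob (A I))"
    using finC A_sets by (intro finite_measure_subadditive_finite) auto
  also have "\<dots> \<le> (\<Sum>I\<in>C. (2 / 3) ^ n)"
    by (intro sum_mono A_prob)
  also have "\<dots> = real (t choose b) * (2 / 3) ^ n"
    by (simp add: C_def n_subsets)
  finally show ?thesis .
qed

text \<open>The number of queries is chosen so that \<open>(2 / 3) ^ n\<close> offsets both the
  binomial coefficient and \<open>1 / \<eta>\<close>. The extra 1 on the right of the event is slack
  that later pays for the first example.\<close>

lemma prob_comp_size_requests_le:
  assumes "b \<le> t" "t \<ge> 1" "0 < \<eta>" "\<eta> \<le> 1"
  shows "prob {\<omega> \<in> space M. comp_size t \<omega> \<le> b \<and>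
      55 * real b * ln (exp 1 * real t / real b) + 24 * ln (4 / \<eta>) < real (requests {t<..2 * t} \<omega>) + 1}
    \<le> \<eta>" (is "prob ?A \<le> \<eta>")
proof -
  define y where "y = real b * ln (exp 1 * real t / real b)"
  define z where "z = ln (1 / \<eta>)"
  have z: "z \<ge> 0"
    using assms by (simp add: z_def)
  have "ln (4 :: real) \<ge> ln (exp 1)"
    using exp_le by (subst ln_le_cancel_iff) auto
  then have z4: "ln (4 / \<eta>) \<ge> 1 + z"
    using assms by (simp add: z_def ln_div)
  have b_le: "real b \<le> y"
  proof (cases "b = 0")
    case False
    then have "exp 1 * 1 \<le> exp 1 * (real t / real b)"
      using assms by (intro mult_left_mono) auto
    then have "ln (exp 1) \<le> ln (exp 1 * real t / real b)"
      using False assms by (subst ln_le_cancel_iff) auto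
    then have "1 \<le> ln (exp 1 * real t / real b)"
      by simp
    from mult_left_mono[OF this, of "real b"] show ?thesis
      by (simp add: y_def)
  qed (simp add: y_def)
  show ?thesis
  proof (cases "2 * b \<le> t")
    \<comment> \<open>At most \<open>t < 2 * b \<le> 2 * y\<close> queries can occur in the epoch,
      and \<open>24 * ln (4 / \<eta>) \<ge> 24\<close> covers the extra 1.\<close>
    case False
    have empty: "?A = {}"
    proof -
      have "real (requests {t<..2 * t} \<omega>) + 1 \<le> 55 * y + 24 * ln (4 / \<eta>)" for \<omega>
      proof -
        have "requests {t<..2 * t} \<omega> \<le> card {t<..2 * t}"
          unfolding requests_def by (intro card_mono) auto
        then show ?thesis
          using False b_le z4 z by simp
      qed
      then show ?thesis
        by (auto simp: y_def not_less mult.assoc)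
    qed
    show ?thesis
      unfolding empty using assms by simp
  next
    case True
    \<comment> \<open>Since \<open>2 / 3 \<le> exp (- 1 / 3)\<close>, this makes
      \<open>(2 / 3) ^ n\<close> at most \<open>exp (- (y + z))\<close>; the binomial coefficient is
      at most \<open>exp y\<close>, and \<open>exp (- z) = \<eta>\<close> remains.\<close>
    define n where "n = nat \<lceil>3 * (y + z)\<rceil>"
    have n: "3 * (y + z) \<le> real n"
      unfolding n_def by (rule real_nat_ceiling_ge)
    have [measurable]: "requests {t<..2 * t} \<in> M \<rightarrow>\<^sub>M count_space UNIV"
      by (intro requests_measurable) auto
    have "?A \<subseteq> {\<omega> \<in> space M. comp_size t \<omega> \<le> b \<and> n \<le> requests {t<..2 * t} \<omega>}"
    proof safe
      fix \<omega>
      assume "55 * real b * ln (exp 1 * real t / real b) + 24 * ln (4 / \<eta>)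
        < real (requests {t<..2 * t} \<omega>) + 1"
      then have "55 * y + 24 * (1 + z) < real (requests {t<..2 * t} \<omega>) + 1"
        using z4 by (simp add: y_def)
      then have "3 * (y + z) \<le> real (requests {t<..2 * t} \<omega>)"
        using b_le z by simp
      then show "n \<le> requests {t<..2 * t} \<omega>"
        by (simp add: n_def nat_le_iff ceiling_le_iff)
    qed
    then have "prob ?A \<le> prob {\<omega> \<in> space M. comp_size t \<omega> \<le> b \<and> n \<le> requests {t<..2 * t} \<omega>}"
      by (rule finite_measure_mono) measurable
    also have "\<dots> \<le> real (t choose b) * (2 / 3) ^ n"
      using True assms by (intro prob_comp_size_requests_le_binomial)
    also have "\<dots> \<le> exp y * exp (- (y + z))"
    proof (intro mult_mono)
      show "real (t choose b) \<le> exp y"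
        unfolding y_def by (rule binomial_le_exp) fact
      have "2 / 3 \<le> exp (- 1 / 3 :: real)"
        using exp_ge_add_one_self[of "- 1 / 3"] by simp
      then have "(2 / 3) ^ n \<le> exp (- 1 / 3 :: real) ^ n"
        by (intro power_mono) auto
      also have "\<dots> = exp (- (real n / 3))"
        by (simp flip: exp_of_nat_mult)
      also have "\<dots> \<le> exp (- (y + z))"
        using n by simp
      finally show "(2 / 3) ^ n \<le> exp (- (y + z))" .
    qed auto
    also have "\<dots> = \<eta>"
      using assms by (simp add: z_def ln_div flip: exp_add)
    finally show ?thesis .
  qed
qed

text \<open>Half of \<open>\<delta>\<close> pays for compression sizes exceeding the
  \<open>b i\<close>, the other half for epochs with too many queries. Outside these events each of
  the \<open>K + 1 \<le> L\<close> epochs has at most \<open>R / L - 1\<close> queries.\<close>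

lemma prob_requests_ge:
  fixes b :: "nat \<Rightarrow> nat" and m :: nat and \<delta> R :: real and d :: "nat \<Rightarrow> real"
  defines "L \<equiv> log 2 (2 * real m)" and "K \<equiv> nat \<lfloor>log 2 (real m)\<rfloor>"
  assumes "m \<ge> 1" "0 < \<delta>" "\<delta> < 1"
    and b: "\<And>i. i \<le> K \<Longrightarrow> b i \<le> 2 ^ i"
    and prob_b: "\<And>i. i \<le> K \<Longrightarrow> prob {\<omega> \<in> space M. comp_size (2 ^ i) \<omega> \<le> b i} \<ge> 1 - d i"
    and d: "(\<Sum>i\<le>K. d i) \<le> \<delta> / 2"
    and R: "\<And>i. i \<le> K \<Longrightarrow>
      (55 * real (b i) * ln (exp 1 * real (2 ^ i) / real (b i)) + 24 * ln (8 * L / \<delta>)) * L \<le> R"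
  shows "prob {\<omega> \<in> space M. real (requests {1..m} \<omega>) \<le> R} \<ge> 1 - \<delta>"
proof -
  \<comment> \<open>Half of \<open>\<delta>\<close>, shared equally among the epochs
    \<open>0, ..., K\<close>.\<close>
  define \<eta> where "\<eta> = \<delta> / (2 * (real K + 1))"
  have \<eta>: "0 < \<eta>" "\<eta> \<le> 1"
    using \<open>0 < \<delta>\<close> \<open>\<delta> < 1\<close> by (auto simp: \<eta>_def divide_simps)
  have log0: "log 2 (real m) \<ge> 0"
    using \<open>m \<ge> 1\<close> by simp
  have L_eq: "L = 1 + log 2 (real m)"
    using \<open>m \<ge> 1\<close> by (simp add: L_def log_mult)
  have "real K \<le> log 2 (real m)"
    using log0 by (simp add: K_def)
  then have KL: "real K + 1 \<le> L"
    by (simp add: L_eq)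
  \<comment> \<open>The epochs up to \<open>K\<close> reach \<open>2 ^ Suc K\<close>, which must be
    at least \<open>m\<close>.\<close>
  have "log 2 (real m) \<le> real (Suc K)"
    unfolding K_def using log0 by linarith
  then have "real m \<le> 2 powr real (Suc K)"
    using \<open>m \<ge> 1\<close> by (simp add: log_le_iff)
  then have "real m \<le> real (2 ^ Suc K)"
    by (simp only: powr_realpow of_nat_power of_nat_numeral zero_less_numeral)
  then have mK: "m \<le> 2 ^ Suc K"
    by (simp only: of_nat_le_iff)
  have ln_le: "ln (4 / \<eta>) \<le> ln (8 * L / \<delta>)"
  proof (subst ln_le_cancel_iff)
    have "4 / \<eta> = 8 * (real K + 1) / \<delta>"
      by (simp add: \<eta>_def)
    also have "\<dots> \<le> 8 * L / \<delta>"
      using KL \<open>0 < \<delta>\<close> by (intro divide_right_mono) auto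
    finally show "4 / \<eta> \<le> 8 * L / \<delta>" .
  qed (use \<eta> KL \<open>0 < \<delta>\<close> in auto)
  define U where "U i = {\<omega> \<in> space M. \<not> comp_size (2 ^ i) \<omega> \<le> b i}" for i
  define V where "V i = {\<omega> \<in> space M. comp_size (2 ^ i) \<omega> \<le> b i \<and>
      55 * real (b i) * ln (exp 1 * real (2 ^ i) / real (b i)) + 24 * ln (4 / \<eta>)
        < real (requests {2 ^ i<..2 * 2 ^ i} \<omega>) + 1}" for i
  define G where "G = {\<omega> \<in> space M. real (requests {1..m} \<omega>) \<le> R}"
  have [measurable]: "U i \<in> events" "V i \<in> events" "G \<in> events" for i
  proof -
    show "U i \<in> events"
      unfolding U_def by measurable
    have [measurable]: "requests {2 ^ i<..2 * 2 ^ i} \<in> M \<rightarrow>\<^sub>M count_space UNIV"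
        "requests {1..m} \<in> M \<rightarrow>\<^sub>M count_space UNIV"
      by (intro requests_measurable; force)+
    show "V i \<in> events" "G \<in> events"
      unfolding V_def G_def by measurable
  qed
  have U: "prob (U i) \<le> d i" if "i \<le> K" for i
  proof -
    have "U i = space M - {\<omega> \<in> space M. comp_size (2 ^ i) \<omega> \<le> b i}"
      by (auto simp: U_def)
    then have "prob (U i) = 1 - prob {\<omega> \<in> space M. comp_size (2 ^ i) \<omega> \<le> b i}"
      by (simp add: prob_compl)
    with prob_b[OF that] show ?thesis by simp
  qed
  have V: "prob (V i) \<le> \<eta>" if "i \<le> K" for i
    unfolding V_def using b[OF that] \<eta> by (intro prob_comp_size_requests_le) auto
  have "space M - G \<subseteq> (\<Union>i\<in>{..K}. U i \<union> V i)"
  proof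
    fix \<omega> assume \<omega>: "\<omega> \<in> space M - G"
    show "\<omega> \<in> (\<Union>i\<in>{..K}. U i \<union> V i)"
    proof (rule ccontr)
      assume "\<omega> \<notin> (\<Union>i\<in>{..K}. U i \<union> V i)"
      with \<omega> have *: "real (requests {2 ^ i<..2 * 2 ^ i} \<omega>) + 1
          \<le> 55 * real (b i) * ln (exp 1 * real (2 ^ i) / real (b i)) + 24 * ln (4 / \<eta>)" if "i \<le> K" for i
        using that by (auto simp: U_def V_def not_less)
      have r: "real (requests {2 ^ i<..2 * 2 ^ i} \<omega>) + 1 \<le> R / L" if "i \<le> K" for i
      proof -
        have "55 * real (b i) * ln (exp 1 * real (2 ^ i) / real (b i)) + 24 * ln (8 * L / \<delta>) \<le> R / L"
          using R[OF that] KL by (subst pos_le_divide_eq) auto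
        with *[OF that] ln_le show ?thesis
          by linarith
      qed
      have "requests {1..m} \<omega> \<le> requests {1..2 ^ Suc K} \<omega>"
        unfolding requests_def using mK by (intro card_mono) auto
      also have "\<dots> \<le> 1 + (\<Sum>i<Suc K. requests {2 ^ i<..2 * 2 ^ i} \<omega>)"
        unfolding requests_def by (rule card_doubling_le)
      finally have "real (requests {1..m} \<omega>)
          \<le> real (1 + (\<Sum>i<Suc K. requests {2 ^ i<..2 * 2 ^ i} \<omega>))"
        by (simp only: of_nat_le_iff)
      \<comment> \<open>The spare 1 in each epoch absorbs the single leading 1, as there is at least
        one epoch.\<close>
      also have "\<dots> \<le> (\<Sum>i<Suc K. real (requests {2 ^ i<..2 * 2 ^ i} \<omega>) + 1)"
        by (simp add: sum.distrib)
      also have "\<dots> \<le> (\<Sum>i<Suc K. R / L)"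
        by (intro sum_mono r) auto
      also have "\<dots> = (real K + 1) * (R / L)"
        by simp
      also have "\<dots> \<le> L * (R / L)"
        \<comment> \<open>Epoch 0 shows \<open>R / L \<ge> 1\<close>, so the factor is
          nonnegative.\<close>
        using r[of 0] by (intro mult_right_mono KL) linarith+
      also have "\<dots> = R"
        using KL by simp
      finally show False
        using \<omega> by (simp add: G_def)
    qed
  qed
  then have "prob (space M - G) \<le> prob (\<Union>i\<in>{..K}. U i \<union> V i)"
    by (intro finite_measure_mono) auto
  also have "\<dots> \<le> (\<Sum>i\<le>K. prob (U i \<union> V i))"
    by (intro finite_measure_subadditive_finite) auto
  also have "\<dots> \<le> (\<Sum>i\<le>K. d i + \<eta>)"
  proof (rule sum_mono)
    fix i assume "i \<in> {..K}"
    then show "prob (U i \<union> V i) \<le> d i + \<eta>"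
      using U[of i] V[of i] measure_Un_le[of "U i" M "V i"] by simp
  qed
  also have "\<dots> = (\<Sum>i\<le>K. d i) + (real K + 1) * \<eta>"
    by (simp add: sum.distrib)
  also have "(real K + 1) * \<eta> = \<delta> / 2"
    by (simp add: \<eta>_def field_simps)
  finally have "prob (space M - G) \<le> \<delta>"
    using d by simp
  then show ?thesis
    unfolding G_def[symmetric] by (simp add: prob_compl)
qed

end

section \<open>From tail bounds to quantiles\<close>

theorem theorem8:
  fixes X :: "'x measure" and F :: "('x \<Rightarrow> int) set" and P :: "('x \<times> int) measure"
    and f :: "'x \<Rightarrow> int" and M :: "'w measure" and Z :: "nat \<Rightarrow> 'w \<Rightarrow> 'x \<times> int"
    and m :: nat and \<delta> :: real and d :: "nat \<Rightarrow> real"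
  assumes "F \<subseteq> classifiers X"
    and "prob_space P" and "sets P = sets (X \<Otimes>\<^sub>M labels)"
    and "realizable X P F f"
    and "measurable_DIS X F f"
    and "prob_space M" and "iid_seq M P Z"
    and "\<And>i \<omega>. i \<ge> 1 \<Longrightarrow> \<omega> \<in> space M \<Longrightarrow> snd (Z i \<omega>) = f (fst (Z i \<omega>))"
    and "m \<ge> 1" and "0 < \<delta>" and "\<delta> < 1"
    and "\<And>t. t \<ge> 1 \<Longrightarrow> 0 < d t \<and> d t \<le> 1"
    and "(\<Sum>i=0..nat \<lfloor>log 2 (real m)\<rfloor>. d (2 ^ i)) \<le> \<delta> / 2"
  shows "(MAX t\<in>{..m}. B_nhat M F Z t \<delta>) \<le> B_N M X F Z m \<delta> \<and>
    real (B_N M X F Z m \<delta>) \<le>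
      (MAX t\<in>{2 ^ i | i. i \<in> {0..nat \<lfloor>log 2 (real m)\<rfloor>}}.
         (55 * real (B_nhat M F Z t (d t)) * ln (exp 1 * real t / real (B_nhat M F Z t (d t)))
            + 24 * ln (8 * log 2 (2 * real m) / \<delta>)) * log 2 (2 * real m))"
proof -
  interpret prob_space M
    by fact
  define x where "x i \<omega> = fst (Z i \<omega>)" for i \<omega>
  have fst_P [measurable]: "fst \<in> P \<rightarrow>\<^sub>M X"
    using measurable_fst measurable_cong_sets[OF assms(3) refl] by blast
  have Z: "indep_vars (\<lambda>_. P) Z {1..}" "\<And>i. i \<ge> 1 \<Longrightarrow> distr M P (Z i) = P"
    using assms(7) by (auto simp: iid_seq_def)
  have Z_meas: "Z i \<in> M \<rightarrow>\<^sub>M P" if "i \<ge> 1" for i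
    using Z(1) that by (auto simp: indep_vars_def)
  \<comment> \<open>Labels are determined by \<open>f\<close>, so the instances alone carry the
    randomness, with the marginal of \<open>P\<close> as their law.\<close>
  interpret S: labelled_sample M X F f x "distr P X fst"
  proof
    show "f \<in> F"
      using assms(4) by (simp add: realizable_def)
    show "indep_vars (\<lambda>_. X) x {1..}"
      using indep_vars_compose2[OF Z(1), of "\<lambda>_. fst" "\<lambda>_. X"] fst_P by (simp add: x_def[abs_def])
    show "distr M X (x i) = distr P X fst" if "i \<ge> 1" for i
      using distr_distr[OF fst_P Z_meas[OF that]] Z(2)[OF that] by (simp add: x_def[abs_def] comp_def)
  qed fact
  have sample: "sample Z t \<omega> = labelled f (\<lambda>i. x i \<omega>) {1..t}" if "\<omega> \<in> space M" for t \<omega>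
    unfolding sample_def labelled_def
  proof (rule image_cong)
    fix i assume "i \<in> {1..t}"
    then show "Z i \<omega> = (x i \<omega>, f (x i \<omega>))"
      using assms(8)[of i \<omega>] that by (simp add: x_def prod_eq_iff)
  qed simp
  have nhat: "nhat F (sample Z t \<omega>) = S.comp_size t \<omega>" if "\<omega> \<in> space M" for t \<omega>
    by (simp add: sample[OF that] S.comp_size_def)
  have queries: "num_queries X F Z m \<omega> = S.requests {1..m} \<omega>" if "\<omega> \<in> space M" for \<omega>
    by (simp add: num_queries_def S.requests_def queried_def region_def sample[OF that] x_def Int_def)
  have B_nhat: "B_nhat M F Z t \<epsilon> = (LEAST b. prob {\<omega> \<in> space M. S.comp_size t \<omega> \<le> b} \<ge> 1 - \<epsilon>)" for t \<epsilon>
    unfolding B_nhat_def by (simp add: nhat cong: conj_cong)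
  have B_N: "B_N M X F Z m \<epsilon> = (LEAST n. prob {\<omega> \<in> space M. S.requests {1..m} \<omega> \<le> n} \<ge> 1 - \<epsilon>)" for \<epsilon>
    unfolding B_N_def by (simp add: queries cong: conj_cong)
  have [measurable]: "S.requests {1..m} \<in> M \<rightarrow>\<^sub>M count_space UNIV"
    by (intro S.requests_measurable) auto
  \<comment> \<open>The trivial bound \<open>t\<close> is admissible, so the least admissible bound
    exists and is at most \<open>t\<close>.\<close>
  have comp_size_t: "prob {\<omega> \<in> space M. S.comp_size t \<omega> \<le> t} \<ge> 1 - \<epsilon>" if "\<epsilon> > 0" for t \<epsilon>
    using that by (simp add: S.comp_size_le prob_space)
  have B_nhat_prob: "prob {\<omega> \<in> space M. S.comp_size t \<omega> \<le> B_nhat M F Z t \<epsilon>} \<ge> 1 - \<epsilon>" if "\<epsilon> > 0" for t \<epsilon>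
    unfolding B_nhat by (rule LeastI) (rule comp_size_t[OF that])
  have B_nhat_le: "B_nhat M F Z t \<epsilon> \<le> t" if "\<epsilon> > 0" for t \<epsilon>
    unfolding B_nhat by (rule Least_le) (rule comp_size_t[OF that])
  have "prob {\<omega> \<in> space M. S.requests {1..m} \<omega> \<le> card {1..m}} = 1"
  proof -
    have "S.requests {1..m} \<omega> \<le> card {1..m}" for \<omega>
      unfolding S.requests_def by (intro card_mono) auto
    then show ?thesis
      by (simp add: prob_space)
  qed
  then have "prob {\<omega> \<in> space M. S.requests {1..m} \<omega> \<le> card {1..m}} \<ge> 1 - \<delta>"
    using \<open>0 < \<delta>\<close> by linarith
  then have B_N_prob: "prob {\<omega> \<in> space M. S.requests {1..m} \<omega> \<le> B_N M X F Z m \<delta>} \<ge> 1 - \<delta>"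
    unfolding B_N by (rule LeastI)
  have lower: "B_nhat M F Z t \<delta> \<le> B_N M X F Z m \<delta>" if "t \<le> m" for t
    unfolding B_nhat[of t]
  proof (rule Least_le, rule order_trans[OF B_N_prob], rule finite_measure_mono)
    show "{\<omega> \<in> space M. S.requests {1..m} \<omega> \<le> B_N M X F Z m \<delta>}
        \<subseteq> {\<omega> \<in> space M. S.comp_size t \<omega> \<le> B_N M X F Z m \<delta>}"
    proof safe
      fix \<omega> assume \<omega>: "\<omega> \<in> space M" "S.requests {1..m} \<omega> \<le> B_N M X F Z m \<delta>"
      have "S.requests {1..t} \<omega> \<le> S.requests {1..m} \<omega>"
        unfolding S.requests_def using that by (intro card_mono) auto
      with \<omega> S.comp_size_le_requests[OF \<omega>(1), of t] show "S.comp_size t \<omega> \<le> B_N M X F Z m \<delta>"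
        by linarith
    qed
  qed measurable
  define T where "T t = (55 * real (B_nhat M F Z t (d t)) * ln (exp 1 * real t / real (B_nhat M F Z t (d t)))
            + 24 * ln (8 * log 2 (2 * real m) / \<delta>)) * log 2 (2 * real m)" for t
  define E :: "nat set" where "E = {2 ^ i | i. i \<in> {0..nat \<lfloor>log 2 (real m)\<rfloor>}}"
  define R where "R = Max (T ` E)"
  have E: "finite E"
    by (simp add: E_def Setcompr_eq_image)
  have "prob {\<omega> \<in> space M. real (S.requests {1..m} \<omega>) \<le> R} \<ge> 1 - \<delta>"
  proof (rule S.prob_requests_ge[where b = "\<lambda>i. B_nhat M F Z (2 ^ i) (d (2 ^ i))" and d = "\<lambda>i. d (2 ^ i)"])
    fix i assume i: "i \<le> nat \<lfloor>log 2 (real m)\<rfloor>"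
    have "0 < d (2 ^ i)"
      using assms(12)[of "2 ^ i"] by simp
    then show "B_nhat M F Z (2 ^ i) (d (2 ^ i)) \<le> 2 ^ i"
        "1 - d (2 ^ i) \<le> prob {\<omega> \<in> space M. S.comp_size (2 ^ i) \<omega> \<le> B_nhat M F Z (2 ^ i) (d (2 ^ i))}"
      by (simp_all only: B_nhat_le B_nhat_prob)
    have "T (2 ^ i) \<le> R"
      unfolding R_def using E i by (intro Max_ge) (auto simp: E_def)
    then show "(55 * real (B_nhat M F Z (2 ^ i) (d (2 ^ i))) *
         ln (exp 1 * real (2 ^ i) / real (B_nhat M F Z (2 ^ i) (d (2 ^ i)))) +
         24 * ln (8 * log 2 (2 * real m) / \<delta>)) * log 2 (2 * real m) \<le> R"
      by (simp only: T_def)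
  qed (use assms in \<open>simp_all add: atLeast0AtMost\<close>)
  \<comment> \<open>The integer bound \<open>nat \<lfloor>R\<rfloor>\<close> is 0 for negative
    \<open>R\<close>, hence the explicit \<open>R \<ge> 0\<close>.\<close>
  also have "{\<omega> \<in> space M. real (S.requests {1..m} \<omega>) \<le> R}
      = {\<omega> \<in> space M. R \<ge> 0 \<and> S.requests {1..m} \<omega> \<le> nat \<lfloor>R\<rfloor>}"
    by (auto simp: le_nat_iff le_floor_iff intro: order_trans[of 0 "real _" R])
  finally have R: "1 - \<delta> \<le> prob {\<omega> \<in> space M. R \<ge> 0 \<and> S.requests {1..m} \<omega> \<le> nat \<lfloor>R\<rfloor>}" .
  \<comment> \<open>For negative \<open>R\<close> the event would be empty, although its probability
    is at least \<open>1 - \<delta> > 0\<close>.\<close>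
  have "R \<ge> 0"
  proof (rule ccontr)
    assume "\<not> R \<ge> 0"
    with R \<open>\<delta> < 1\<close> show False
      by simp
  qed
  with R have "B_N M X F Z m \<delta> \<le> nat \<lfloor>R\<rfloor>"
    unfolding B_N by (intro Least_le) simp
  with \<open>R \<ge> 0\<close> have "real (B_N M X F Z m \<delta>) \<le> R"
    by (simp add: le_nat_iff le_floor_iff)
  moreover have "(MAX t\<in>{..m}. B_nhat M F Z t \<delta>) \<le> B_N M X F Z m \<delta>"
    using lower by (subst Max_le_iff) auto
  ultimately show ?thesis
    unfolding R_def T_def E_def by blast
qed

end
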